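(* Let $f:\mathbb{C}\to\mathbb{C}$ be a transcendental entire function, let $R>0$ be such that $M(r,f)>r$ for all $r\geq R$, and suppose that $A_R(f)$ is a spider's web. Assume also that $A(f)\subset J(f)$. Then the residual Julia set $J_r(f)$ is a spider's web.
   Context: For a transcendental entire function $f$, $f^n$ denotes the $n$th iterate. The Fatou set $F(f)$ is the set of $z\in\mathbb{C}$ such that $\{f^n:n\in\mathbb{N}\}$ is a normal family in some neighbourhood of $z$; the Julia set is $J(f)=\mathbb{C}\setminus F(f)$. A Fatou component is a connected component of $F(f)$. The residual Julia set $J_r(f)$ is the set of points in $J(f)$ that do not lie on the boundary of any Fatou component. For $r>0$, $M(r,f)=\max_{|z|=r}|f(z)|$, and $M^n(r,f)$ denotes the $n$th iterate of the function $r\mapsto M(r,f)$ evaluated at $r$. For $R>0$ such that $M(r,f)>r$ for all $r\geq R$, define $$A_R(f)=\{z\in\mathbb{C}: |f^n(z)|\geq M^n(R,f)\text{ for } n\in\mathbb{N}\},$$ and the fast escaping set $$A(f)=\{z\in\mathbb{C}: \text{there exists }\ell\in\mathbb{N}\text{ such that } |f^{n+\ell}(z)|\geq M^n(R,f)\text{ for } n\in\mathbb{N}\}.$$ A set $E\subset\mathbb{C}$ is a spider's web if $E$ is connected and there exists a sequence $(G_k)_{k\in\mathbb{N}}$ of bounded, simply connected domains such that $G_k\subset G_{k+1}$ and $\partial G_k\subset E$ for each $k\in\mathbb{N}$, and $\bigcup_{k\in\mathbb{N}}G_k=\mathbb{C}$. *)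

theory Defs
  imports "HOL-Complex_Analysis.Complex_Analysis"
begin

definition entire :: "(complex \<Rightarrow> complex) \<Rightarrow> bool" where
  "entire f \<longleftrightarrow> f holomorphic_on UNIV"

definition transcendental_entire :: "(complex \<Rightarrow> complex) \<Rightarrow> bool" where
  "transcendental_entire f \<longleftrightarrow> entire f \<and> \<not> (\<exists>p. \<forall>z. f z = poly p z)"

(* Normality is with respect to the Riemann sphere: the constant limit infinity is allowed.
   The dichotomy between a holomorphic limit and the limit infinity is the usual definition on
   a domain, i.e. for connected U. *)
definition locally_uniformly_to ::
    "complex set \<Rightarrow> (nat \<Rightarrow> complex \<Rightarrow> complex) \<Rightarrow> (complex \<Rightarrow> complex) \<Rightarrow> bool" where
  "locally_uniformly_to U s g \<longleftrightarrow>
     (\<forall>K. compact K \<and> K \<subseteq> U \<longrightarrow> uniform_limit K s g sequentially)"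

definition locally_uniformly_to_infinity ::
    "complex set \<Rightarrow> (nat \<Rightarrow> complex \<Rightarrow> complex) \<Rightarrow> bool" where
  "locally_uniformly_to_infinity U s \<longleftrightarrow>
     (\<forall>K. compact K \<and> K \<subseteq> U \<longrightarrow>
        (\<forall>B::real. \<forall>\<^sub>F n in sequentially. \<forall>z\<in>K. B \<le> cmod (s n z)))"

definition normal_family_on :: "complex set \<Rightarrow> (complex \<Rightarrow> complex) set \<Rightarrow> bool" where
  "normal_family_on U \<F> \<longleftrightarrow>
     (\<forall>s :: nat \<Rightarrow> complex \<Rightarrow> complex. range s \<subseteq> \<F> \<longrightarrow>
        (\<exists>r :: nat \<Rightarrow> nat. strict_mono r \<and>
           ((\<exists>g. g holomorphic_on U \<and> locally_uniformly_to U (s \<circ> r) g) \<or>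
            locally_uniformly_to_infinity U (s \<circ> r))))"

definition fatou_set :: "(complex \<Rightarrow> complex) \<Rightarrow> complex set" where
  "fatou_set f =
     {z. \<exists>U. open U \<and> connected U \<and> z \<in> U \<and> normal_family_on U (range (\<lambda>n::nat. f ^^ n))}"

definition julia_set :: "(complex \<Rightarrow> complex) \<Rightarrow> complex set" where
  "julia_set f = - fatou_set f"

definition fatou_components :: "(complex \<Rightarrow> complex) \<Rightarrow> complex set set" where
  "fatou_components f = components (fatou_set f)"

definition residual_julia_set :: "(complex \<Rightarrow> complex) \<Rightarrow> complex set" where
  "residual_julia_set f = {z \<in> julia_set f. \<forall>U \<in> fatou_components f. z \<notin> frontier U}"

(* For continuous f and r \<ge> 0 the supremum is attained, so it is the maximum modulus.
   Negative r never occur in the iterates of this function at a positive radius. *)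
definition max_modulus :: "(complex \<Rightarrow> complex) \<Rightarrow> real \<Rightarrow> real" where
  "max_modulus f r = (SUP z \<in> sphere 0 r. cmod (f z))"

definition fast_escaping_level :: "real \<Rightarrow> (complex \<Rightarrow> complex) \<Rightarrow> complex set" where
  "fast_escaping_level R f = {z. \<forall>n::nat. cmod ((f ^^ n) z) \<ge> (max_modulus f ^^ n) R}"

(* A(f) does not depend on R as long as max_modulus f r > r for all r \<ge> R; as in its
   definition, R is kept as a parameter. *)
definition fast_escaping_set :: "real \<Rightarrow> (complex \<Rightarrow> complex) \<Rightarrow> complex set" where
  "fast_escaping_set R f =
     {z. \<exists>l::nat. \<forall>n::nat. cmod ((f ^^ (n + l)) z) \<ge> (max_modulus f ^^ n) R}"

definition spiders_web :: "complex set \<Rightarrow> bool" where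
  "spiders_web E \<longleftrightarrow>
     connected E \<and>
     (\<exists>G :: nat \<Rightarrow> complex set.
        (\<forall>k. G k \<noteq> {} \<and> open (G k) \<and> connected (G k) \<and> bounded (G k) \<and> simply_connected (G k)) \<and>
        (\<forall>k. G k \<subseteq> G (Suc k) \<and> frontier (G k) \<subseteq> E) \<and>
        (\<Union>k. G k) = UNIV)"

end

theory Submission
  imports Defs
begin

text \<open>
  Write \<open>R\<^sub>m\<close> for the iterates \<open>M\<^sup>m(R)\<close>, which increase to infinity. A hole \<open>H\<close> of the web
  \<open>A\<^sub>R(f)\<close> containing the disc of radius \<open>R\<close> has images \<open>H\<^sub>m = f\<^sup>m(H)\<close> that contain the disc of
  radius \<open>R\<^sub>m\<close>, lie in the disc of radius \<open>R\<^sub>m\<^sub>+\<^sub>p\<close> for a fixed \<open>p\<close>, and have their boundaries in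
  \<open>A(f)\<close>. A connected set missing \<open>A(f)\<close> therefore lies inside \<open>H\<^sub>m\<close> or outside the disc of
  radius \<open>R\<^sub>m\<close>, and the same holds for all its forward images.

  This has two consequences. If the closure of such a set \<open>V\<close> contains a fast escaping point, then
  \<open>f\<^sup>n(V)\<close> cannot lie in \<open>H\<^sub>m\<close> for \<open>m < n - p\<close>, so \<open>V\<close> itself is fast escaping, which is absurd;
  applied to Fatou components, \<open>A(f) \<subseteq> J(f)\<close> gives \<open>A(f) \<subseteq> J\<^sub>r(f)\<close>. And on a disc missing \<open>A(f)\<close>
  every sequence of iterates either has a bounded subsequence or tends to infinity, so by Montel's
  theorem \<open>J(f)\<close> lies in the closure of \<open>A(f)\<close>. Finally, \<open>A(f)\<close> is the union of the preimages of
  \<open>A\<^sub>R(f)\<close> under iterates, each of which is connected: a relatively clopen piece of a preimage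
  missing \<open>A\<^sub>R(f)\<close> would contain a compact one, whose image would be all of the unbounded set
  \<open>A\<^sub>R(f)\<close>. So \<open>J\<^sub>r(f)\<close> is connected, and it inherits the loops of \<open>A\<^sub>R(f)\<close>.
\<close>

section \<open>Spiders' webs\<close>

lemma incseq_open_cover_contains_compact:
  fixes G :: "nat \<Rightarrow> 'a::topological_space set"
  assumes "\<And>k. open (G k)" "\<And>k. G k \<subseteq> G (Suc k)" "(\<Union>k. G k) = UNIV" "compact K"
  obtains k where "K \<subseteq> G k"
proof -
  have "incseq G"
    using assms(2) by (rule incseq_SucI)
  obtain F where F: "finite F" "K \<subseteq> (\<Union>k\<in>F. G k)"
    using compactE_image[OF assms(4), of UNIV G] assms(1,3) by auto
  obtain k where "\<And>i. i \<in> F \<Longrightarrow> i \<le> k"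
    using F(1) finite_nat_set_iff_bounded_le by auto
  then have "K \<subseteq> G k"
    using F(2) incseqD[OF \<open>incseq G\<close>] by blast
  then show thesis
    by (rule that)
qed

text \<open>Otherwise one \<open>G k\<close> contains the closure of \<open>E\<close>, hence its own
  frontier; being open, it is then the whole plane.\<close>

lemma spiders_web_not_bounded:
  assumes "spiders_web E"
  shows "\<not> bounded E"
proof
  assume "bounded E"
  obtain G :: "nat \<Rightarrow> complex set" where G: "\<And>k. open (G k)" "\<And>k. bounded (G k)" "\<And>k. G k \<noteq> {}"
      "\<And>k. G k \<subseteq> G (Suc k)" "\<And>k. frontier (G k) \<subseteq> E" "(\<Union>k. G k) = UNIV"
    using assms unfolding spiders_web_def by blast
  obtain k where "closure E \<subseteq> G k"
    using incseq_open_cover_contains_compact[OF G(1,4,6)] \<open>bounded E\<close> compact_closure by metis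
  then have "frontier (G k) \<subseteq> G k"
    using G(5)[of k] closure_subset by blast
  then have "frontier (G k) = {}"
    using G(1)[of k] frontier_disjoint_eq by blast
  then have "G k = UNIV"
    using G(3)[of k] frontier_eq_empty by metis
  then show False
    using G(2)[of k] by simp
qed

text \<open>In a separation of the preimage, the connected set \<open>E\<close> lies on one side.
  The other side, cut by some \<open>G k\<close>, has an image that is compact and clopen in
  \<open>E\<close>, so \<open>E\<close> would be bounded.\<close>

lemma connected_vimage_spiders_web:
  assumes web: "spiders_web E" and "closed E"
    and cont: "continuous_on UNIV g" and open_map: "\<And>U. open U \<Longrightarrow> open (g ` U)"
    and sub: "E \<subseteq> g -` E"
  shows "connected (g -` E)"
proof -
  obtain G :: "nat \<Rightarrow> complex set" where G: "\<And>k. open (G k)" "\<And>k. bounded (G k)"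
      "\<And>k. frontier (G k) \<subseteq> E" "(\<Union>k. G k) = UNIV"
    using web unfolding spiders_web_def by blast
  have "connected E"
    using web unfolding spiders_web_def by blast
  have closedK: "closed (g -` E)"
    using \<open>closed E\<close> cont by (simp add: continuous_on_closed_vimage)
  have aux: "T = {}" if "closed S" "closed T" "S \<union> T = g -` E" "S \<inter> T = {}" "E \<inter> T = {}" for S T
  proof (rule ccontr)
    assume "T \<noteq> {}"
    then obtain t k where t: "t \<in> T" "t \<in> G k"
      using G(4) by blast
    define C where "C = T \<inter> G k"
    \<comment> \<open>The frontier of \<open>G k\<close> lies in \<open>E\<close>, which misses
      \<open>T\<close>, so cutting by \<open>G k\<close> loses no limit points.\<close>
    have "C = T \<inter> closure (G k)"
      unfolding C_def closure_Un_frontier using G(3)[of k] that(5) by blast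
    then have "compact C"
      using \<open>closed T\<close> G(2) by (simp add: closed_Int_compact compact_closure)
    then have compact: "compact (g ` C)"
      using cont compact_continuous_image continuous_on_subset by blast
    \<comment> \<open>Points of \<open>G k - S\<close> sent into \<open>E\<close> must lie in
      \<open>T\<close>; since \<open>G k - S\<close> is open, the image of \<open>C\<close> is open
      relative to \<open>E\<close>.\<close>
    have eq: "g ` (G k - S) \<inter> E = g ` C"
      unfolding C_def using that(3,4) by blast
    have "closed (- g ` (G k - S))"
      using open_map G(1)[of k] \<open>closed S\<close> by (simp add: closed_Compl open_Diff)
    then have "g ` C \<inter> E = {} \<or> - g ` (G k - S) \<inter> E = {}"
      using eq compact
      by (intro connected_closedD[OF \<open>connected E\<close>]) (auto simp: compact_imp_closed)
    moreover have "g t \<in> g ` C \<inter> E"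
      using t that(3) unfolding C_def by blast
    ultimately have "E \<subseteq> g ` C"
      using eq by blast
    then have "bounded E"
      using compact bounded_subset compact_imp_bounded by blast
    then show False
      using spiders_web_not_bounded[OF web] by blast
  qed
  show ?thesis
    unfolding connected_closed_set[OF closedK]
  proof clarify
    fix S T assume ST: "closed S" "closed T" "S \<noteq> {}" "T \<noteq> {}" "S \<union> T = g -` E" "S \<inter> T = {}"
    then have "S \<inter> E = {} \<or> T \<inter> E = {}"
      using sub by (intro connected_closedD[OF \<open>connected E\<close>]) auto
    then show False
      using aux[of S T] aux[of T S] ST by (auto simp: Int_commute Un_commute)
  qed
qed

lemma frontier_open_image_subset:
  fixes g :: "'a::euclidean_space \<Rightarrow> 'b::metric_space"
  assumes "bounded H" "continuous_on (closure H) g" "open (g ` H)"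
  shows "frontier (g ` H) \<subseteq> g ` frontier H" "closure (g ` H) \<subseteq> g ` closure H"
proof -
  have "compact (g ` closure H)"
    using assms(1,2) compact_closure compact_continuous_image by blast
  then show *: "closure (g ` H) \<subseteq> g ` closure H"
    by (meson closure_minimal closure_subset compact_imp_closed image_mono)
  show "frontier (g ` H) \<subseteq> g ` frontier H"
  proof -
    have "frontier (g ` H) = closure (g ` H) - g ` H"
      using assms(3) by (simp add: frontier_def interior_open)
    then show ?thesis
      using * unfolding closure_Un_frontier[of H] image_Un by blast
  qed
qed

section \<open>Growth of the maximum modulus\<close>

locale max_modulus_growth =
  fixes f :: "complex \<Rightarrow> complex" and R :: real
  assumes holomorphic: "f holomorphic_on UNIV"
    and nonconstant: "\<not> f constant_on UNIV"
    and R_pos: "R > 0"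
    and growth: "r \<ge> R \<Longrightarrow> max_modulus f r > r"
begin

abbreviation rad :: "nat \<Rightarrow> real" where
  "rad m \<equiv> (max_modulus f ^^ m) R"

lemma holomorphic_iterate: "(f ^^ n) holomorphic_on UNIV"
proof (induction n)
  case (Suc n)
  then show ?case
    using holomorphic_on_compose_gen[OF Suc holomorphic] by (simp add: o_def)
qed (simp add: id_def)

lemma continuous_iterate: "continuous_on S (f ^^ n)"
  using holomorphic_iterate holomorphic_on_imp_continuous_on continuous_on_subset by blast

lemma open_image: "open U \<Longrightarrow> open (f ` U)"
  using open_mapping_thm[OF holomorphic open_UNIV connected_UNIV _ subset_UNIV nonconstant] .

lemma open_image_iterate: "open U \<Longrightarrow> open ((f ^^ n) ` U)"
proof (induction n)
  case (Suc n)
  then have "open (f ` ((f ^^ n) ` U))"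
    by (simp add: open_image)
  then show ?case
    by (simp add: image_image)
qed simp

lemma continuous_f: "continuous_on S f"
  using continuous_iterate[of S 1] by simp

lemma cmod_le_max_modulus:
  assumes "cmod z \<le> r"
  shows "cmod (f z) \<le> max_modulus f r"
proof (rule maximum_modulus_frontier[where f = f and S = "cball 0 r" and \<xi> = z])
  have "compact ((\<lambda>z. cmod (f z)) ` sphere 0 r)"
    by (intro compact_continuous_image continuous_intros continuous_f) simp
  then have bdd: "bdd_above ((\<lambda>z. cmod (f z)) ` sphere 0 r)"
    by (simp add: bounded_imp_bdd_above compact_imp_bounded)
  show "cmod (f w) \<le> max_modulus f r" if "w \<in> frontier (cball 0 r)" for w
    unfolding max_modulus_def using bdd that by (auto intro: cSUP_upper)
qed (use assms holomorphic holomorphic_on_subset continuous_f in auto)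

lemma rad_ge: "rad m \<ge> R"
  by (induction m) (use growth in force)+

lemma rad_pos: "rad m > 0"
  using rad_ge[of m] R_pos by linarith

lemma incseq_rad: "incseq rad"
  by (rule incseq_SucI) (use growth rad_ge in \<open>force intro: less_imp_le\<close>)

text \<open>A finite limit \<open>L\<close> would give \<open>max_modulus f L \<le> L\<close>,
  against \<open>growth\<close>. The bound holds on the open disc and passes to the circle by
  continuity of \<open>f\<close>.\<close>

lemma rad_unbounded: obtains m where "rad m > B"
proof -
  have "\<exists>m. rad m > B"
  proof (rule ccontr)
    assume "\<not> ?thesis"
    then have "\<And>m. rad m \<le> B"
      by (meson not_less)
    then obtain L where L: "rad \<longlonglongrightarrow> L" "\<And>m. rad m \<le> L"
      using incseq_convergent[OF incseq_rad] by blast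
    have "L \<ge> R"
      using L(2)[of 0] by simp
    have le: "cmod (f z) \<le> L" if "z \<in> ball 0 L" for z
    proof -
      obtain m where "rad m > cmod z"
        using order_tendstoD(1)[OF L(1), of "cmod z"] \<open>z \<in> ball 0 L\<close>
        by (auto dest: eventually_happens)
      then show ?thesis
        using cmod_le_max_modulus[of z "rad m"] L(2)[of "Suc m"] by force
    qed
    have "f ` closure (ball 0 L) \<subseteq> closure (cball 0 L)"
      using le by (intro image_closure_subset[OF continuous_f]) auto
    then have "cmod (f z) \<le> L" if "z \<in> sphere 0 L" for z
      using that \<open>L \<ge> R\<close> R_pos by (auto simp: closure_ball image_subset_iff)
    moreover have "sphere (0::complex) L \<noteq> {}"
      using \<open>L \<ge> R\<close> R_pos by simp
    ultimately have "max_modulus f L \<le> L"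
      unfolding max_modulus_def by (intro cSUP_least) auto
    then show False
      using growth[OF \<open>L \<ge> R\<close>] by simp
  qed
  then show thesis
    using that by blast
qed

lemma cmod_iterate_le_rad: "cmod z \<le> rad m \<Longrightarrow> cmod ((f ^^ n) z) \<le> rad (m + n)"
  by (induction n) (auto intro: cmod_le_max_modulus)

section \<open>The fast escaping set\<close>

lemma fast_escaping_set_eq:
  "fast_escaping_set R f = (\<Union>l. (f ^^ l) -` fast_escaping_level R f)"
  unfolding fast_escaping_set_def fast_escaping_level_def by (auto simp: funpow_add)

lemma fast_escaping_set_iterateD:
  assumes "(f ^^ n) z \<in> fast_escaping_set R f"
  shows "z \<in> fast_escaping_set R f"
proof -
  obtain l where "(f ^^ (l + n)) z \<in> fast_escaping_level R f"
    using assms unfolding fast_escaping_set_eq by (auto simp: funpow_add)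
  then show ?thesis
    unfolding fast_escaping_set_eq by blast
qed

lemma fast_escaping_level_subset: "fast_escaping_level R f \<subseteq> fast_escaping_set R f"
  unfolding fast_escaping_set_eq using UN_upper[of 0 UNIV "\<lambda>l. (f ^^ l) -` fast_escaping_level R f"]
  by simp

lemma iterate_fast_escaping_level:
  assumes "z \<in> fast_escaping_level R f"
  shows "(f ^^ n) z \<in> fast_escaping_level R f" "cmod ((f ^^ n) z) \<ge> rad n"
proof -
  have *: "rad k \<le> cmod ((f ^^ k) z)" for k
    using assms unfolding fast_escaping_level_def by blast
  then show "cmod ((f ^^ n) z) \<ge> rad n" .
  have "rad k \<le> cmod ((f ^^ (k + n)) z)" for k
    using *[of "k + n"] incseqD[OF incseq_rad, of k "k + n"] by simp
  then show "(f ^^ n) z \<in> fast_escaping_level R f"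
    unfolding fast_escaping_level_def by (simp add: funpow_add)
qed

lemma closed_fast_escaping_level: "closed (fast_escaping_level R f)"
  unfolding fast_escaping_level_def
  by (intro closed_Collect_all closed_Collect_le continuous_intros continuous_iterate)

text \<open>By forward invariance, all the preimages contain the level set, so their union is
  connected once each of them is.\<close>

lemma connected_fast_escaping_set:
  assumes "spiders_web (fast_escaping_level R f)"
  shows "connected (fast_escaping_set R f)"
proof -
  have sub: "fast_escaping_level R f \<subseteq> (f ^^ l) -` fast_escaping_level R f" for l
    using iterate_fast_escaping_level(1) by blast
  have "fast_escaping_level R f \<noteq> {}"
    using spiders_web_not_bounded[OF assms] by auto
  then have "(\<Inter>l. (f ^^ l) -` fast_escaping_level R f) \<noteq> {}"
    using sub by blast
  then show ?thesis
    unfolding fast_escaping_set_eq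
    by (intro connected_Union)
      (auto intro!: connected_vimage_spiders_web assms closed_fast_escaping_level
        continuous_iterate open_image_iterate sub)
qed

end

section \<open>Holes of the web\<close>

locale web_hole = max_modulus_growth +
  fixes H :: "complex set"
  assumes open_H: "open H" and bounded_H: "bounded H"
    and ball_subset_H: "ball 0 R \<subseteq> H"
    and frontier_H: "frontier H \<subseteq> fast_escaping_level R f"
begin

abbreviation hole :: "nat \<Rightarrow> complex set" where
  "hole m \<equiv> (f ^^ m) ` H"

lemma frontier_hole: "frontier (hole m) \<subseteq> (f ^^ m) ` fast_escaping_level R f"
  using frontier_open_image_subset(1)[OF bounded_H continuous_iterate open_image_iterate[OF open_H]]
    frontier_H by blast

lemma frontier_hole_subset: "frontier (hole m) \<subseteq> fast_escaping_set R f"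
  using frontier_hole[of m] iterate_fast_escaping_level(1) fast_escaping_level_subset by blast

lemma ball_subset_hole: "ball 0 (rad m) \<subseteq> hole m"
proof (induction m)
  case 0
  then show ?case
    using ball_subset_H by simp
next
  case (Suc m)
  have "0 \<in> ball (0::complex) (rad m)"
    using rad_pos by simp
  then have "f 0 \<in> f ` hole m"
    using Suc by blast
  then have "f 0 \<in> hole (Suc m)"
    by (simp add: image_image)
  \<comment> \<open>\<open>f 0\<close> may lie on the circle itself; since the hole is open, it
    still meets the open disc.\<close>
  moreover have "f 0 \<in> closure (ball 0 (rad (Suc m)))"
    using cmod_le_max_modulus[of 0 "rad m"] rad_pos[of m] rad_pos[of "Suc m"] by simp
  ultimately have meet: "ball 0 (rad (Suc m)) \<inter> hole (Suc m) \<noteq> {}"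
    using open_image_iterate[OF open_H, of "Suc m"] open_Int_closure_eq_empty by blast
  have "ball 0 (rad (Suc m)) \<inter> frontier (hole (Suc m)) = {}"
    using frontier_hole[of "Suc m"] iterate_fast_escaping_level(2)[of _ "Suc m"] by force
  then show ?case
    using connected_Int_frontier[OF connected_ball meet] by blast
qed

text \<open>One shift \<open>p\<close> serves all \<open>m\<close>: choose it for \<open>H\<close>
  and iterate the maximum modulus bound.\<close>

lemma closure_hole_subset:
  obtains p where "\<And>m. closure (hole m) \<subseteq> cball 0 (rad (p + m))"
proof -
  obtain B where B: "\<And>z. z \<in> closure H \<Longrightarrow> cmod z \<le> B"
    using bounded_closure[OF bounded_H] unfolding bounded_iff by blast
  obtain p where "rad p > B"
    using rad_unbounded .
  then have "cmod ((f ^^ m) z) \<le> rad (p + m)" if "z \<in> closure H" for m z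
    using B[OF that] by (intro cmod_iterate_le_rad) linarith
  then have "closure (hole m) \<subseteq> cball 0 (rad (p + m))" for m
    using frontier_open_image_subset(2)[OF bounded_H continuous_iterate
        open_image_iterate[OF open_H], of m] by fastforce
  then show thesis
    by (rule that)
qed

section \<open>Connected sets that miss the fast escaping set\<close>

text \<open>Points whose iterates are fast escaping are fast escaping, so the image of
  \<open>V\<close> cannot cross the frontier of a hole.\<close>

lemma iterate_image_dichotomy:
  assumes "connected V" "V \<inter> fast_escaping_set R f = {}"
  shows "(f ^^ n) ` V \<subseteq> hole m \<or> (\<forall>z\<in>V. rad m \<le> cmod ((f ^^ n) z))"
proof -
  have "connected ((f ^^ n) ` V)"
    using assms(1) continuous_iterate connected_continuous_image by blast
  moreover have "(f ^^ n) ` V \<inter> frontier (hole m) = {}"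
    using assms(2) frontier_hole_subset[of m] fast_escaping_set_iterateD by blast
  ultimately have "(f ^^ n) ` V \<subseteq> hole m \<or> (f ^^ n) ` V \<inter> hole m = {}"
    using connected_Int_frontier[of "(f ^^ n) ` V" "hole m"] by blast
  then show ?thesis
    using ball_subset_hole[of m] by force
qed

lemma closure_disjoint_fast_escaping_set:
  assumes "connected V" "V \<inter> fast_escaping_set R f = {}"
  shows "closure V \<inter> fast_escaping_set R f = {}"
proof (rule ccontr)
  assume "\<not> ?thesis"
  then obtain z l where z: "z \<in> closure V" "(f ^^ l) z \<in> fast_escaping_level R f"
    unfolding fast_escaping_set_eq by blast
  obtain p where p: "\<And>m. closure (hole m) \<subseteq> cball 0 (rad (p + m))"
    using closure_hole_subset by blast
  obtain u where "u \<in> V"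
    using z(1) by fastforce
  \<comment> \<open>The delay \<open>l\<close> brings \<open>z\<close> into the level set;
    \<open>Suc p\<close> more steps push its orbit strictly beyond the closure of
    \<open>hole n\<close>.\<close>
  have "rad n \<le> cmod ((f ^^ (n + (Suc p + l))) u)" for n
  proof -
    define k where "k = n + Suc p + l"
    have "\<not> (f ^^ k) ` V \<subseteq> hole n"
    proof
      assume "(f ^^ k) ` V \<subseteq> hole n"
      then have "(f ^^ k) ` closure V \<subseteq> closure (hole n)"
        using closure_subset[of "hole n"]
        by (intro image_closure_subset continuous_iterate closed_closure) (rule subset_trans)
      then have "cmod ((f ^^ k) z) \<le> rad (p + n)"
        using z(1) p[of n] by force
      moreover have "cmod ((f ^^ k) z) \<ge> rad (Suc (p + n))"
      proof -
        have "(f ^^ k) z = (f ^^ (n + Suc p)) ((f ^^ l) z)"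
          by (simp only: k_def funpow_add o_apply)
        moreover have "Suc (p + n) = n + Suc p"
          by simp
        ultimately show ?thesis
          using iterate_fast_escaping_level(2)[OF z(2), of "n + Suc p"] by (simp only:)
      qed
      moreover have "rad (p + n) < rad (Suc (p + n))"
        using growth rad_ge by simp
      ultimately show False
        by linarith
    qed
    then show ?thesis
      using iterate_image_dichotomy[OF assms, of k n] \<open>u \<in> V\<close> by (simp add: k_def add.assoc)
  qed
  then have "u \<in> fast_escaping_set R f"
    unfolding fast_escaping_set_def by blast
  then show False
    using assms(2) \<open>u \<in> V\<close> by blast
qed

text \<open>If infinitely many terms map \<open>V\<close> into one hole, they are uniformly bounded
  and Montel's theorem applies. Otherwise each hole captures only finitely many images, and the
  whole sequence tends to infinity uniformly on \<open>V\<close>.\<close>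

lemma normal_family_off_fast_escaping_set:
  assumes "open V" "connected V" "V \<inter> fast_escaping_set R f = {}"
  shows "normal_family_on V (range (\<lambda>n::nat. f ^^ n))"
  unfolding normal_family_on_def
proof (intro allI impI)
  fix s :: "nat \<Rightarrow> complex \<Rightarrow> complex"
  assume "range s \<subseteq> range (\<lambda>n::nat. f ^^ n)"
  \<comment> \<open>The exponents \<open>q j\<close> may repeat or decrease, so the case split below
    counts indices \<open>j\<close>, not exponents.\<close>
  then have "\<exists>q. \<forall>j. s j = f ^^ q j"
    by (intro choice) blast
  then obtain q where q: "\<And>j. s j = f ^^ q j"
    by blast
  show "\<exists>r :: nat \<Rightarrow> nat. strict_mono r \<and>
           ((\<exists>g. g holomorphic_on V \<and> locally_uniformly_to V (s \<circ> r) g) \<or>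
            locally_uniformly_to_infinity V (s \<circ> r))"
  proof (cases "\<exists>m. infinite {j. s j ` V \<subseteq> hole m}")
    case True
    then obtain m where "infinite {j. s j ` V \<subseteq> hole m}" ..
    then obtain r :: "nat \<Rightarrow> nat" where r: "strict_mono r" "\<And>j. s (r j) ` V \<subseteq> hole m"
      using infinite_enumerate[of "{j. s j ` V \<subseteq> hole m}"] by auto
    obtain p where p: "\<And>m. closure (hole m) \<subseteq> cball 0 (rad (p + m))"
      using closure_hole_subset by blast
    have bound: "cmod (s (r j) z) \<le> rad (p + m)" if "z \<in> V" for j z
      using r(2)[of j] p[of m] closure_subset[of "hole m"] that by fastforce
    obtain g r' where g: "g holomorphic_on V" "strict_mono (r' :: nat \<Rightarrow> nat)"
      "\<And>K. compact K \<Longrightarrow> K \<subseteq> V \<Longrightarrow> uniform_limit K ((\<lambda>j. s (r j)) \<circ> r') g sequentially"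
    proof (rule Montel[OF \<open>open V\<close>, of "range (\<lambda>j. s (r j))" "\<lambda>j. s (r j)"])
      show "h holomorphic_on V" if "h \<in> range (\<lambda>j. s (r j))" for h
        using that q holomorphic_on_subset[OF holomorphic_iterate subset_UNIV] by auto
      show "\<exists>B. \<forall>h\<in>range (\<lambda>j. s (r j)). \<forall>z\<in>K. cmod (h z) \<le> B" if "K \<subseteq> V" for K
        using bound that by (intro exI[of _ "rad (p + m)"]) auto
    qed auto
    have "locally_uniformly_to V (s \<circ> (r \<circ> r')) g"
      using g(3) unfolding locally_uniformly_to_def by (simp add: o_def)
    then show ?thesis
      using g(1) strict_mono_o[OF r(1) g(2)] by blast
  next
    case False
    have "\<forall>\<^sub>F n in sequentially. \<forall>z\<in>V. B \<le> cmod (s n z)" for B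
    proof -
      obtain m where m: "rad m > B"
        using rad_unbounded .
      have "finite {j. \<not> \<not> s j ` V \<subseteq> hole m}"
        using False by simp
      then have "\<forall>\<^sub>F n in sequentially. \<not> s n ` V \<subseteq> hole m"
        by (simp add: eventually_cofinite cofinite_eq_sequentially[symmetric])
      then show ?thesis
      proof eventually_elim
        case (elim n)
        then have "\<forall>z\<in>V. rad m \<le> cmod (s n z)"
          using iterate_image_dichotomy[OF assms(2,3), of "q n" m] q by simp
        then show ?case
          using m by force
      qed
    qed
    then have "locally_uniformly_to_infinity V s"
      unfolding locally_uniformly_to_infinity_def by (blast intro: eventually_mono)
    then show ?thesis
      using strict_mono_id by fastforce
  qed
qed

lemma julia_set_subset_closure: "julia_set f \<subseteq> closure (fast_escaping_set R f)"
proof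
  fix z assume z: "z \<in> julia_set f"
  show "z \<in> closure (fast_escaping_set R f)"
  proof (rule ccontr)
    assume "z \<notin> closure (fast_escaping_set R f)"
    then obtain e where "e > 0" "ball z e \<subseteq> - closure (fast_escaping_set R f)"
      using open_contains_ball[of "- closure (fast_escaping_set R f)"] by auto
    then have "normal_family_on (ball z e) (range (\<lambda>n::nat. f ^^ n))"
      using closure_subset[of "fast_escaping_set R f"]
      by (intro normal_family_off_fast_escaping_set) auto
    then have "z \<in> fatou_set f"
      unfolding fatou_set_def using \<open>e > 0\<close> open_ball connected_ball centre_in_ball by blast
    then show False
      using z unfolding julia_set_def by blast
  qed
qed

lemma fast_escaping_set_subset_residual:
  assumes "fast_escaping_set R f \<subseteq> julia_set f"
  shows "fast_escaping_set R f \<subseteq> residual_julia_set f"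
proof -
  have "fast_escaping_set R f \<inter> frontier U = {}" if "U \<in> fatou_components f" for U
  proof -
    have U: "connected U" "U \<subseteq> fatou_set f"
      using that unfolding fatou_components_def
      by (auto simp: in_components_connected dest: in_components_subset)
    then have "U \<inter> fast_escaping_set R f = {}"
      using assms unfolding julia_set_def by blast
    then have "closure U \<inter> fast_escaping_set R f = {}"
      using closure_disjoint_fast_escaping_set U(1) by blast
    then show ?thesis
      unfolding frontier_def by blast
  qed
  then show ?thesis
    using assms unfolding residual_julia_set_def by blast
qed

end

theorem theorem5p3:
  fixes f :: "complex \<Rightarrow> complex" and R :: real
  assumes "transcendental_entire f"
    and "R > 0"
    and "\<And>r. r \<ge> R \<Longrightarrow> max_modulus f r > r"
    and "spiders_web (fast_escaping_level R f)"
    and "fast_escaping_set R f \<subseteq> julia_set f"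
  shows "spiders_web (residual_julia_set f)"
proof -
  have hol: "f holomorphic_on UNIV"
    using assms(1) unfolding transcendental_entire_def entire_def by blast
  have nonconst: "\<not> f constant_on UNIV"
  proof
    assume "f constant_on UNIV"
    then obtain c where "\<And>z. f z = c"
      unfolding constant_on_def by blast
    then have "\<forall>z. f z = poly [:c:] z"
      by simp
    then show False
      using assms(1) unfolding transcendental_entire_def by blast
  qed
  interpret max_modulus_growth f R
    using hol nonconst assms(2,3) by unfold_locales auto
  obtain G :: "nat \<Rightarrow> complex set" where G:
      "\<And>k. G k \<noteq> {} \<and> open (G k) \<and> connected (G k) \<and> bounded (G k) \<and> simply_connected (G k)"
      "\<And>k. G k \<subseteq> G (Suc k)" "\<And>k. frontier (G k) \<subseteq> fast_escaping_level R f"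
      "(\<Union>k. G k) = UNIV"
    using assms(4) unfolding spiders_web_def by blast
  obtain k where k: "cball 0 R \<subseteq> G k"
    using incseq_open_cover_contains_compact[of G "cball 0 R"] G by auto
  interpret web_hole f R "G k"
  proof
    show "ball 0 R \<subseteq> G k"
      using k ball_subset_cball by blast
  qed (use G in auto)
  have A_sub: "fast_escaping_set R f \<subseteq> residual_julia_set f"
    using fast_escaping_set_subset_residual[OF assms(5)] .
  have "residual_julia_set f \<subseteq> closure (fast_escaping_set R f)"
    using julia_set_subset_closure unfolding residual_julia_set_def by blast
  \<comment> \<open>A set between a connected set and its closure is connected.\<close>
  then have "connected (residual_julia_set f)"
    using connected_intermediate_closure[OF connected_fast_escaping_set[OF assms(4)] A_sub] by blast
  \<comment> \<open>Here \<open>k\<close> is arbitrary again, no longer the index of the chosen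
    hole.\<close>
  moreover have "frontier (G k) \<subseteq> residual_julia_set f" for k
    using G(3)[of k] fast_escaping_level_subset A_sub by blast
  ultimately show ?thesis
    unfolding spiders_web_def using G(1,2,4) by blast
qed

end
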